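(* Let $q_0\ne\pm2$ be rational, $\delta=q_0^2-4$, and let $n\ge1$. Let $q_n,q_{n+1},\widehat q_n,\widehat q_{n+1}\in\mathbb C$ be arbitrary roots of $C_{2^n}(z)-q_0$, $C_{2^{n+1}}(z)-q_0$, $C_{2^n}(z)+q_0$, $C_{2^{n+1}}(z)+q_0$ respectively, let $\xi_{n-1}$ be a root of $C_{2^{n-1}}(x)$, and $\sqrt{-\delta}$ a square root of $-\delta$. Put $L_n=\mathbb Q(q_n,\widehat q_n)$, $M_n^+=\mathbb Q(q_{n+1},\widehat q_n)$, $M_n^-=\mathbb Q(q_n,\widehat q_{n+1})$. Then $L_n=\mathbb Q(\sqrt{-\delta},\xi_{n-1},q_n)=\mathbb Q(\sqrt{-\delta},\xi_{n-1},\widehat q_n)$, $M_n^+=\mathbb Q(\sqrt{-\delta},\xi_{n-1},q_{n+1})$ and $M_n^-=\mathbb Q(\sqrt{-\delta},\xi_{n-1},\widehat q_{n+1})$; in particular these fields do not depend on the choice of roots.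
   Context: Chebyshev polynomials: $U_0=0$, $U_1=1$, $U_{n+1}=qU_n-U_{n-1}$; $C_n=U_{n+1}-U_{n-1}$ (so $C_0=2$, $C_1=q$, $C_{n+1}=qC_n-C_{n-1}$, and $C_{2m}(q)=C_m(q)^2-2$). *)

theory Defs
  imports
    Complex_Main
    "HOL-Computational_Algebra.Polynomial"
    "HOL-Algebra.Generated_Fields"
    "HOL-Algebra.Algebraic_Closure_Type"
begin

fun cheb_U :: "nat \<Rightarrow> 'a::comm_ring_1 poly" where
  "cheb_U 0 = 0"
| "cheb_U (Suc 0) = 1"
| "cheb_U (Suc (Suc n)) = [:0, 1:] * cheb_U (Suc n) - cheb_U n"

(* C_n = U_(n+1) - U_(n-1); at n = 0 the recurrence extends backwards to U_(-1) = -1,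
   so C_0 = 2. *)
definition cheb_C :: "nat \<Rightarrow> 'a::comm_ring_1 poly" where
  "cheb_C n = (case n of 0 \<Rightarrow> 2 | Suc m \<Rightarrow> cheb_U (Suc (Suc m)) - cheb_U m)"

lemma cheb_C_0: "cheb_C 0 = 2"
  by (simp add: cheb_C_def)

lemma cheb_C_1: "cheb_C (Suc 0) = [:0, 1:]"
  by (simp add: cheb_C_def)

lemma cheb_C_rec: "cheb_C (Suc (Suc n)) = [:0, 1:] * cheb_C (Suc n) - cheb_C n"
proof (cases n)
  case 0
  have "[:0, 1:] * [:0, 1:] - 1 - 1 = [:0, 1:] * [:0, 1:] - (2 :: 'a poly)"
    by (simp only: diff_diff_eq one_add_one)
  then show ?thesis
    unfolding 0 cheb_C_def by (simp only: nat.case cheb_U.simps mult_1_right diff_zero)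
next
  case (Suc m)
  then show ?thesis
    unfolding cheb_C_def by (simp only: nat.case cheb_U.simps) (simp only: algebra_simps)
qed

lemma cheb_C_mult: "cheb_C (k + n) * cheb_C n = cheb_C (k + 2 * n) + cheb_C k"
proof (induction n arbitrary: k rule: cheb_U.induct)
  case 1
  show ?case by (simp add: cheb_C_0 mult_2_right)
next
  case 2
  have "cheb_C (Suc (Suc k)) = [:0, 1:] * cheb_C (Suc k) - (cheb_C k :: 'a poly)"
    by (rule cheb_C_rec)
  then show ?case by (simp add: cheb_C_1 mult.commute)
next
  case (3 n)
  have "cheb_C (k + Suc (Suc n)) * cheb_C (Suc (Suc n)) =
      [:0, 1:] * (cheb_C (Suc k + Suc n) * cheb_C (Suc n)) -
      cheb_C (Suc (Suc k) + n) * (cheb_C n :: 'a poly)"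
    by (simp only: cheb_C_rec[of n] add_Suc add_Suc_right) (simp only: algebra_simps)
  also have "\<dots> = [:0, 1:] * (cheb_C (Suc k + 2 * Suc n) + cheb_C (Suc k)) -
      (cheb_C (Suc (Suc k) + 2 * n) + cheb_C (Suc (Suc k)))"
    by (simp only: 3)
  also have "\<dots> = ([:0, 1:] * cheb_C (Suc (Suc (Suc (k + 2 * n)))) -
      cheb_C (Suc (Suc (k + 2 * n)))) + cheb_C k"
    by (simp only: cheb_C_rec[of k] add_Suc add_Suc_right mult_Suc_right numeral_2_eq_2 mult_Suc
          mult_0 add_0_right add_0) (simp only: algebra_simps)
  also have "\<dots> = cheb_C (k + 2 * Suc (Suc n)) + cheb_C k"
    by (simp only: cheb_C_rec[symmetric]) (simp add: numeral_2_eq_2)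
  finally show ?case .
qed

lemma cheb_C_double: "cheb_C (2 * m) = (cheb_C m)\<^sup>2 - (2 :: 'a::comm_ring_1 poly)"
  using cheb_C_mult[of 0 m, where 'a = 'a]
  by (simp add: cheb_C_0 power2_eq_square)

definition rat_adjoin :: "complex set \<Rightarrow> complex set" where
  "rat_adjoin S = generate_field ring_of_type_algebra (\<rat> \<union> S)"

lemma rat_adjoin_subfield: "subfield (rat_adjoin S) ring_of_type_algebra"
  unfolding rat_adjoin_def
  by (intro field.generate_field_is_subfield field_from_type_algebra)
     (simp add: ring_of_type_algebra_def)

lemma rat_adjoin_incl: "\<rat> \<union> S \<subseteq> rat_adjoin S"
  unfolding rat_adjoin_def by (auto intro: generate_field.incl)

lemma rat_adjoin_least:
  "subfield K ring_of_type_algebra \<Longrightarrow> \<rat> \<union> S \<subseteq> K \<Longrightarrow> rat_adjoin S \<subseteq> K"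
  unfolding rat_adjoin_def
  by (intro field.generate_field_min_subfield1 field_from_type_algebra)
     (simp_all add: ring_of_type_algebra_def)

end

theory Submission
  imports Defs
begin

text \<open>Write \<open>q\<^sub>0 = t + 1/t\<close>, so that \<open>t\<^sup>2 \<noteq> 1\<close>, and put \<open>N = 2\<^sup>n\<close>. As \<open>C\<^sub>m(x + 1/x) = x\<^sup>m + 1/x\<^sup>m\<close>,
  the roots are \<open>q\<^sub>n = a + 1/a\<close> and \<open>q\<^sub>n' = b + 1/b\<close> (the hatted root) with \<open>a\<^sup>N = t\<close> and
  \<open>b\<^sup>N = -t\<close>, while \<open>\<xi> = x + 1/x\<close> with \<open>x\<^sup>N = -1\<close>; both \<open>x\<close> and \<open>b/a\<close> are primitive
  \<open>2N\<close>-th roots of unity. For \<open>z = x\<^sup>k\<close>,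
  \<open>2 (z a + 1/(z a)) = (z + 1/z) (a + 1/a) + (z - 1/z) (a - 1/a)\<close>,
  and the last product is a multiple of \<open>i (t - 1/t) = \<plusminus>s\<close> by an element of \<open>\<rat>(\<xi>, a + 1/a)\<close>.
  Conversely \<open>z + 1/z\<close>, for \<open>z = b/a\<close>, is a root of the quadratic
  \<open>X\<^sup>2 - q\<^sub>n q\<^sub>n' X + q\<^sub>n\<^sup>2 + q\<^sub>n'\<^sup>2 - 4\<close> and of \<open>C\<^bsub>N/2\<^esub>\<close>, whereas the other root
  \<open>z a\<^sup>2 + 1/(z a\<^sup>2)\<close> of the quadratic is not a root of \<open>C\<^bsub>N/2\<^esub>\<close> because \<open>t\<^sup>2 \<noteq> 1\<close>; hence
  \<open>z + 1/z\<close> lies in \<open>\<rat>(q\<^sub>n, q\<^sub>n')\<close>.\<close>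

section \<open>Subfields of the complex numbers and elements of the form
  \<open>a + 1 / a\<close>\<close>

lemma power_plus_inverse_rec:
  fixes x :: "'a :: field"
  assumes "x \<noteq> 0"
  shows "x ^ Suc (Suc k) + 1 / x ^ Suc (Suc k) =
    (x + 1 / x) * (x ^ Suc k + 1 / x ^ Suc k) - (x ^ k + 1 / x ^ k)"
proof -
  define y where "y = 1 / x"
  have y: "x * y = 1" "\<And>j. 1 / x ^ j = y ^ j"
    using assms by (simp_all add: y_def power_divide)
  have "x ^ Suc (Suc k) + y ^ Suc (Suc k) =
      (x + y) * (x ^ Suc k + y ^ Suc k) - (x * y) * (x ^ k + y ^ k)"
    by (simp add: algebra_simps)
  then show ?thesis
    by (simp only: y mult_1_left y_def[symmetric])
qed

text \<open>The closure conditions use the type class operations instead of those of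
  \<open>ring_of_type_algebra\<close>, so that membership goals yield to introduction rules.\<close>

locale complex_subfield =
  fixes K :: "complex set"
  assumes Rats_subset: "\<rat> \<subseteq> K"
    and add_mem: "x \<in> K \<Longrightarrow> y \<in> K \<Longrightarrow> x + y \<in> K"
    and mult_mem: "x \<in> K \<Longrightarrow> y \<in> K \<Longrightarrow> x * y \<in> K"
    and uminus_mem: "x \<in> K \<Longrightarrow> - x \<in> K"
    and inverse_mem: "x \<in> K \<Longrightarrow> inverse x \<in> K"
begin

lemma diff_mem: "x \<in> K \<Longrightarrow> y \<in> K \<Longrightarrow> x - y \<in> K"
  using add_mem[of x "- y"] uminus_mem[of y] by simp

lemma divide_mem: "x \<in> K \<Longrightarrow> y \<in> K \<Longrightarrow> x / y \<in> K"
  by (simp add: divide_inverse mult_mem inverse_mem)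

lemma zero_mem: "0 \<in> K" and one_mem: "1 \<in> K" and numeral_mem: "numeral w \<in> K"
  using Rats_subset by auto

lemma power_mem: "x \<in> K \<Longrightarrow> x ^ k \<in> K"
  by (induction k) (auto intro: one_mem mult_mem)

lemmas field_mem = diff_mem divide_mem zero_mem one_mem numeral_mem power_mem
  add_mem mult_mem uminus_mem

lemma power_plus_inverse_mem:
  assumes "a + 1 / a \<in> K" "a \<noteq> 0"
  shows "a ^ k + 1 / a ^ k \<in> K"
\<comment> \<open>The induction rule of \<open>cheb_U\<close> serves as two-step induction with base
  cases 0 and 1.\<close>
proof (induction k rule: cheb_U.induct)
  case (3 k)
  have "a ^ Suc (Suc k) + 1 / a ^ Suc (Suc k) =
      (a + 1 / a) * (a ^ Suc k + 1 / a ^ Suc k) - (a ^ k + 1 / a ^ k)"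
    by (rule power_plus_inverse_rec[OF assms(2)])
  also have "\<dots> \<in> K"
    using 3 assms(1) by (intro diff_mem mult_mem)
  finally show ?case .
qed (use assms in \<open>auto intro: numeral_mem\<close>)

text \<open>The quotient is the value of U_k at \<open>a + 1 / a\<close>; the induction builds it
  from U_(k+1) = (q U_k + C_k) / 2.\<close>

lemma power_minus_inverse_factor:
  assumes "a + 1 / a \<in> K" "a \<noteq> 0"
  shows "\<exists>u\<in>K. a ^ k - 1 / a ^ k = u * (a - 1 / a)"
proof (induction k)
  case 0
  show ?case by (intro bexI[of _ 0]) (auto intro: zero_mem)
next
  case (Suc k)
  then obtain u where u: "u \<in> K" "a ^ k - 1 / a ^ k = u * (a - 1 / a)"
    by blast
  have "2 * (a ^ Suc k - 1 / a ^ Suc k) =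
      (a + 1 / a) * (a ^ k - 1 / a ^ k) + (a ^ k + 1 / a ^ k) * (a - 1 / a)"
    by (simp add: algebra_simps add_divide_distrib diff_divide_distrib)
  also have "\<dots> = ((a + 1 / a) * u + (a ^ k + 1 / a ^ k)) * (a - 1 / a)"
    unfolding u(2) by (simp only: algebra_simps)
  finally have "a ^ Suc k - 1 / a ^ Suc k =
      ((a + 1 / a) * u + (a ^ k + 1 / a ^ k)) / 2 * (a - 1 / a)"
    by (simp add: mult.commute)
  moreover have "((a + 1 / a) * u + (a ^ k + 1 / a ^ k)) / 2 \<in> K"
    by (intro field_mem u assms power_plus_inverse_mem)
  ultimately show ?case by blast
qed

text \<open>As \<open>x ^ m\<close> is a square root of -1, \<open>s\<close> is
  \<open>x ^ m * (t - 1 / t)\<close> up to sign. Each factor is antisymmetric under inversion, of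
  \<open>x\<close> or of \<open>a\<close>, so \<open>power_minus_inverse_factor\<close> applies to
  both.\<close>

lemma sqrt_eq_multiple:
  assumes "a + 1 / a \<in> K" "x + 1 / x \<in> K" "a \<noteq> 0" "x \<noteq> 0"
    and "x ^ (2 * m) = -1" "a ^ M = t" "s\<^sup>2 = - (t - 1 / t)\<^sup>2"
  shows "\<exists>u\<in>K. s = u * ((x - 1 / x) * (a - 1 / a))"
proof -
  obtain u where u: "u \<in> K" "x ^ m - 1 / x ^ m = u * (x - 1 / x)"
    using power_minus_inverse_factor assms by blast
  obtain v where v: "v \<in> K" "t - 1 / t = v * (a - 1 / a)"
    using power_minus_inverse_factor assms by blast
  \<comment> \<open>The factor 1/2 compensates for
    \<open>x ^ m - 1 / x ^ m = 2 * x ^ m\<close>.\<close>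
  define r where "r = u * v / 2 * ((x - 1 / x) * (a - 1 / a))"
  have j: "(x ^ m)\<^sup>2 = -1"
    using assms(5) by (simp add: power_even_eq)
  then have "1 / x ^ m = - (x ^ m)"
    using assms(4) by (simp add: field_simps power2_eq_square)
  then have "x ^ m = u / 2 * (x - 1 / x)"
    using u(2) by (simp add: field_simps)
  then have "r = x ^ m * (t - 1 / t)"
    by (simp only: v(2) r_def) simp
  then have "s\<^sup>2 = r\<^sup>2"
    using j assms(7) by (simp add: power_mult_distrib)
  then have "s = u * v / 2 * ((x - 1 / x) * (a - 1 / a)) \<or>
      s = - (u * v / 2) * ((x - 1 / x) * (a - 1 / a))"
    by (auto simp: r_def power2_eq_iff)
  moreover have "u * v / 2 \<in> K" "- (u * v / 2) \<in> K"
    by (intro field_mem u v)+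
  ultimately show ?thesis by blast
qed

text \<open>Since \<open>s\<close> is nonzero, the multiplier in \<open>sqrt_eq_multiple\<close> can
  be inverted. This puts the product \<open>(x - 1 / x) * (a - 1 / a)\<close> into \<open>K\<close>,
  although its factors need not lie there.\<close>

lemma twist_mem:
  assumes "a + 1 / a \<in> K" "x + 1 / x \<in> K" "s \<in> K" "a \<noteq> 0" "x \<noteq> 0"
    and "x ^ (2 * m) = -1" "a ^ M = t" "s\<^sup>2 = - (t - 1 / t)\<^sup>2" "s \<noteq> 0"
  shows "x ^ k * a + 1 / (x ^ k * a) \<in> K"
proof -
  define p where "p = (x - 1 / x) * (a - 1 / a)"
  obtain u where u: "u \<in> K" "s = u * p"
    using sqrt_eq_multiple assms unfolding p_def by blast
  then have "p = s / u" using assms(9) by auto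
  then have p: "p \<in> K" using divide_mem u(1) assms(3) by metis
  obtain w where w: "w \<in> K" "x ^ k - 1 / x ^ k = w * (x - 1 / x)"
    using power_minus_inverse_factor assms by blast
  have "x ^ k * a + 1 / (x ^ k * a) =
      ((x ^ k + 1 / x ^ k) * (a + 1 / a) + (x ^ k - 1 / x ^ k) * (a - 1 / a)) / 2"
    by (simp add: algebra_simps add_divide_distrib diff_divide_distrib)
  also have "\<dots> = ((x ^ k + 1 / x ^ k) * (a + 1 / a) + w * p) / 2"
    by (simp add: w(2) p_def)
  also have "\<dots> \<in> K"
    by (intro field_mem p w assms power_plus_inverse_mem)
  finally show ?thesis .
qed

text \<open>This is the remainder of C_k modulo X^2 - \<sigma> X + \<pi>. The coefficients are
  chosen before \<open>w\<close>, so they serve both roots of the quadratic.\<close>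

lemma cheb_C_linear_mod_quadratic:
  assumes "\<sigma> \<in> K" "\<pi> \<in> K"
  shows "\<exists>\<alpha>\<in>K. \<exists>\<beta>\<in>K. \<forall>w. w\<^sup>2 = \<sigma> * w - \<pi> \<longrightarrow> poly (cheb_C k) w = \<alpha> * w + \<beta>"
proof (induction k rule: cheb_U.induct)
  case 1
  show ?case
    by (intro bexI[of _ 0] bexI[of _ 2]) (auto simp: cheb_C_0 intro: field_mem)
next
  case 2
  show ?case
    by (intro bexI[of _ 0] bexI[of _ 1]) (auto simp: cheb_C_1 intro: field_mem)
next
  case (3 k)
  obtain \<alpha> \<beta> where 1: "\<alpha> \<in> K" "\<beta> \<in> K"
    "\<And>w. w\<^sup>2 = \<sigma> * w - \<pi> \<Longrightarrow> poly (cheb_C (Suc k)) w = \<alpha> * w + \<beta>"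
    using 3(1) by blast
  obtain \<gamma> \<epsilon> where 2: "\<gamma> \<in> K" "\<epsilon> \<in> K"
    "\<And>w. w\<^sup>2 = \<sigma> * w - \<pi> \<Longrightarrow> poly (cheb_C k) w = \<gamma> * w + \<epsilon>"
    using 3(2) by blast
  have "poly (cheb_C (Suc (Suc k))) w = (\<alpha> * \<sigma> + \<beta> - \<gamma>) * w + (- (\<alpha> * \<pi>) - \<epsilon>)"
    if w: "w\<^sup>2 = \<sigma> * w - \<pi>" for w
  proof -
    have "poly (cheb_C (Suc (Suc k))) w = w * (\<alpha> * w + \<beta>) - (\<gamma> * w + \<epsilon>)"
      using 1(3)[OF w] 2(3)[OF w] by (simp add: cheb_C_rec)
    also have "\<dots> = \<alpha> * w\<^sup>2 + \<beta> * w - \<gamma> * w - \<epsilon>"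
      by (simp add: algebra_simps power2_eq_square)
    finally show ?thesis
      unfolding w by (simp add: algebra_simps)
  qed
  moreover have "\<alpha> * \<sigma> + \<beta> - \<gamma> \<in> K" "- (\<alpha> * \<pi>) - \<epsilon> \<in> K"
    by (intro field_mem 1 2 assms)+
  ultimately show ?case by blast
qed

text \<open>The linear remainder vanishes at \<open>w\<close> but not at \<open>w'\<close>, so it is
  not constant, and \<open>w\<close> is its only zero.\<close>

lemma root_mem_if_conjugate_not_root:
  assumes "w + w' \<in> K" "w * w' \<in> K"
    and "poly (cheb_C k) w = 0" "poly (cheb_C k) w' \<noteq> 0"
  shows "w \<in> K"
proof -
  obtain \<alpha> \<beta> where ab: "\<alpha> \<in> K" "\<beta> \<in> K"
    "\<And>v. v\<^sup>2 = (w + w') * v - w * w' \<Longrightarrow> poly (cheb_C k) v = \<alpha> * v + \<beta>"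
    using cheb_C_linear_mod_quadratic[OF assms(1,2)] by blast
  have w: "\<alpha> * w + \<beta> = 0"
    using ab(3)[of w] assms(3) by (simp add: algebra_simps power2_eq_square)
  have w': "\<alpha> * w' + \<beta> \<noteq> 0"
    using ab(3)[of w'] assms(4) by (simp add: algebra_simps power2_eq_square)
  have "\<alpha> \<noteq> 0" using w w' by auto
  then have "w = - \<beta> / \<alpha>"
    using w by (simp add: field_simps eq_neg_iff_add_eq_0)
  then show ?thesis using field_mem ab by metis
qed

end

section \<open>The generated fields \<open>rat_adjoin S\<close> as complex subfields\<close>

lemma complex_subfield_rat_adjoin: "complex_subfield (rat_adjoin S)"
proof -
  let ?R = "ring_of_type_algebra :: complex ring"
  interpret R: field ?R by (rule field_from_type_algebra)
  have sf: "subfield (rat_adjoin S) ?R" by (rule rat_adjoin_subfield)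
  then have sr: "subring (rat_adjoin S) ?R"
    using subfieldE(1) subfield.axioms subcring.axioms by blast
  have zero: "\<zero>\<^bsub>?R\<^esub> = 0" and one: "\<one>\<^bsub>?R\<^esub> = 1"
    and add: "\<And>x y. x \<oplus>\<^bsub>?R\<^esub> y = x + y" and mult: "\<And>x y. x \<otimes>\<^bsub>?R\<^esub> y = x * y"
    and carrier: "carrier ?R = UNIV"
    by (simp_all add: ring_of_type_algebra_def)
  show ?thesis
  proof
    show "\<rat> \<subseteq> rat_adjoin S" using rat_adjoin_incl by blast
  next
    fix x y assume "x \<in> rat_adjoin S" "y \<in> rat_adjoin S"
    then show "x + y \<in> rat_adjoin S" "x * y \<in> rat_adjoin S"
      using subringE(6,7)[OF sr] add mult by metis+
  next
    fix x assume x: "x \<in> rat_adjoin S"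
    \<comment> \<open>Negation is obtained as multiplication by -1, which avoids the additive
      inverse of the ring record.\<close>
    have "-1 \<in> rat_adjoin S" using rat_adjoin_incl by fastforce
    then show "- x \<in> rat_adjoin S"
      using subringE(6)[OF sr _ x, of "-1"] by (simp add: mult)
    show "inverse x \<in> rat_adjoin S"
    proof (cases "x = 0")
      case False
      have "inv\<^bsub>?R\<^esub> x \<in> rat_adjoin S"
        using R.subfield_m_inv(1)[OF sf] x False by (simp add: zero)
      moreover have "x * inv\<^bsub>?R\<^esub> x = 1"
        using R.subfield_m_inv(2)[OF sf] x False by (simp add: zero one mult)
      ultimately show ?thesis
        using inverse_unique by metis
    qed (use x in simp)
  qed
qed

lemma rat_adjoin_mem: "x \<in> S \<Longrightarrow> x \<in> rat_adjoin S"
  using rat_adjoin_incl by blast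

lemma rat_adjoin_subsetI: "S \<subseteq> rat_adjoin T \<Longrightarrow> rat_adjoin S \<subseteq> rat_adjoin T"
  using rat_adjoin_least[OF rat_adjoin_subfield] rat_adjoin_incl by (metis Un_subset_iff)

section \<open>Chebyshev polynomials at \<open>x + 1 / x\<close>, and roots of unity\<close>

lemma obtain_plus_inverse:
  obtains x :: complex where "x \<noteq> 0" "z = x + 1 / x"
proof -
  define x where "x = (z + csqrt (z\<^sup>2 - 4)) / 2"
  have "(2 * x - z)\<^sup>2 = z\<^sup>2 - 4" by (simp add: x_def)
  then have "4 * (x * (z - x)) = 4 * 1" by (simp add: power2_eq_square algebra_simps)
  then have eq: "x * (z - x) = 1" by (subst (asm) mult_left_cancel) simp_all
  then have "x \<noteq> 0" by auto
  moreover have "z - x = 1 / x"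
    using eq \<open>x \<noteq> 0\<close> by (simp only: eq_divide_eq mult.commute) simp
  then have "z = x + 1 / x" by (metis add_diff_cancel_left' diff_add_cancel add.commute)
  ultimately show ?thesis by (rule that)
qed

lemma plus_inverse_eq_iff:
  fixes x y :: complex
  assumes "x \<noteq> 0" "y \<noteq> 0"
  shows "x + 1 / x = y + 1 / y \<longleftrightarrow> x = y \<or> x = 1 / y"
proof -
  have "x * y * ((x + 1 / x) - (y + 1 / y)) = (x - y) * (x * y - 1)"
    using assms by (simp add: algebra_simps)
  then have "x + 1 / x = y + 1 / y \<longleftrightarrow> x = y \<or> x * y = 1"
    using assms by (metis (no_types) mult_eq_0_iff right_minus_eq)
  then show ?thesis using assms by (simp add: eq_divide_eq)
qed

lemma poly_cheb_C_plus_inverse: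
  fixes x :: complex
  assumes "x \<noteq> 0"
  shows "poly (cheb_C k) (x + 1 / x) = x ^ k + 1 / x ^ k"
proof (induction k rule: cheb_U.induct)
  case (3 k)
  then show ?case
    using power_plus_inverse_rec[OF assms, of k] by (simp add: cheb_C_rec)
qed (auto simp: cheb_C_0 cheb_C_1)

lemma poly_cheb_C_plus_inverse_eq_0_iff:
  fixes x :: complex
  assumes "x \<noteq> 0"
  shows "poly (cheb_C k) (x + 1 / x) = 0 \<longleftrightarrow> x ^ (2 * k) = -1"
proof -
  define v where "v = x ^ k"
  have v: "v \<noteq> 0" "x ^ (2 * k) = v\<^sup>2"
    using assms by (simp_all add: v_def power_even_eq)
  have "v * (v + 1 / v) = v\<^sup>2 + 1"
    using v(1) by (simp add: algebra_simps power2_eq_square)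
  then have "v + 1 / v = 0 \<longleftrightarrow> v\<^sup>2 = -1"
    using v(1) by (metis eq_neg_iff_add_eq_0 mult_eq_0_iff)
  then show ?thesis
    unfolding poly_cheb_C_plus_inverse[OF assms] v(2) v_def .
qed

text \<open>Replacing \<open>a\<close> by \<open>1 / a\<close> keeps \<open>z\<close> and inverts
  \<open>a ^ k\<close>, so the exact value \<open>t\<close> can be arranged.\<close>

lemma obtain_cheb_C_root:
  fixes z :: complex
  assumes "poly (cheb_C k) z = t + 1 / t" "t \<noteq> 0"
  obtains a where "a \<noteq> 0" "z = a + 1 / a" "a ^ k = t"
proof -
  obtain a where a: "a \<noteq> 0" "z = a + 1 / a" by (rule obtain_plus_inverse)
  then have "a ^ k + 1 / a ^ k = t + 1 / t"
    using assms poly_cheb_C_plus_inverse by simp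
  then have "a ^ k = t \<or> a ^ k = 1 / t"
    using plus_inverse_eq_iff a assms by simp
  then show ?thesis
  proof
    assume "a ^ k = 1 / t"
    then have "(1 / a) ^ k = t" by (simp add: power_divide)
    then show ?thesis using that[of "1 / a"] a by (simp add: add.commute)
  qed (use that a in blast)
qed

lemma obtain_cheb_C_zero:
  fixes z :: complex
  assumes "poly (cheb_C k) z = 0"
  obtains x where "x \<noteq> 0" "z = x + 1 / x" "x ^ (2 * k) = -1"
proof -
  \<comment> \<open>Zero is the value of \<open>t + 1 / t\<close> at
    \<open>t = \<i>\<close>.\<close>
  have "poly (cheb_C k) z = \<i> + 1 / \<i>" using assms by simp
  then obtain x where x: "x \<noteq> 0" "z = x + 1 / x" "x ^ k = \<i>"
    using obtain_cheb_C_root[of k z \<i>] by auto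
  then have "x ^ (2 * k) = -1" by (simp add: power_even_eq)
  then show ?thesis using that x by blast
qed

text \<open>Here C_2 is applied first, whereas \<open>cheb_C_double\<close> applies it last. This
  form turns a root \<open>q\<close> at one level into the root \<open>q^2 - 2\<close> at the level
  below.\<close>

lemma poly_cheb_C_double:
  "poly (cheb_C (2 * k)) (z :: complex) = poly (cheb_C k) (z\<^sup>2 - 2)"
proof -
  obtain x where x: "x \<noteq> 0" "z = x + 1 / x" by (rule obtain_plus_inverse)
  have "z\<^sup>2 - 2 = x\<^sup>2 + 1 / x\<^sup>2"
    using x by (simp add: power2_sum power_divide)
  then show ?thesis
    using poly_cheb_C_plus_inverse[of x "2 * k"] poly_cheb_C_plus_inverse[of "x\<^sup>2" k] x
    by (simp add: power_mult)
qed

text \<open>The order of \<open>x\<close> is exactly 2^(n+1), so \<open>x\<close> generates all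
  roots of unity whose order divides 2^(n+1).\<close>

lemma root_of_unity_is_power:
  fixes x y :: complex
  assumes "x ^ (2 ^ n) = -1" "y ^ (2 ^ l) = 1" "l \<le> Suc n"
  shows "\<exists>k. y = x ^ k"
  using assms(2,3)
proof (induction l arbitrary: y)
  case 0
  then show ?case by (intro exI[of _ 0]) simp
next
  case (Suc l)
  then have l: "l \<le> n" "l \<le> Suc n" by auto
  have "(y ^ 2 ^ l)\<^sup>2 = 1"
    using Suc.prems(1) by (simp flip: power_mult add: mult.commute)
  then consider "y ^ 2 ^ l = 1" | "y ^ 2 ^ l = -1"
    by (auto simp: power2_eq_1_iff)
  then show ?case
  proof cases
    case 1
    then show ?thesis using Suc.IH l by blast
  next
    case 2
    \<comment> \<open>A power of \<open>x\<close> with \<open>z ^ 2 ^ l = -1\<close>: multiplying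
      \<open>y\<close> by it corrects the sign, and the induction hypothesis applies.\<close>
    define z where "z = x ^ (2 ^ (n - l))"
    have "z ^ 2 ^ l = -1"
      using assms(1) l(1) by (simp add: z_def flip: power_mult power_add)
    then have "(y * z) ^ 2 ^ l = 1" using 2 by (simp add: power_mult_distrib)
    then obtain k where k: "y * z = x ^ k" using Suc.IH l by blast
    \<comment> \<open>As \<open>x ^ (2 * 2 ^ n) = 1\<close>, the inverse of \<open>z\<close> is a
      power of \<open>x\<close> with natural exponent; this bound keeps the subtraction from
      truncating.\<close>
    have "(2::nat) ^ (n - l) \<le> 2 * 2 ^ n"
      by (rule order_trans[of _ "2 ^ n"]) auto
    then have "z * x ^ (2 * 2 ^ n - 2 ^ (n - l)) = x ^ (2 * 2 ^ n)"
      unfolding z_def by (metis le_add_diff_inverse power_add)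
    also have "\<dots> = 1" using assms(1) by (simp add: power_even_eq)
    finally have "y = x ^ (k + (2 * 2 ^ n - 2 ^ (n - l)))"
      by (metis k mult.assoc mult.right_neutral power_add)
    then show ?thesis by blast
  qed
qed

section \<open>Field inclusions in both directions and the resulting equalities\<close>

lemma sqrt_discriminant:
  fixes s t :: complex
  assumes "t \<noteq> 0" "s\<^sup>2 = 4 - (t + 1 / t)\<^sup>2" "(t + 1 / t)\<^sup>2 \<noteq> 4"
  shows "s\<^sup>2 = - (t - 1 / t)\<^sup>2" "s \<noteq> 0" "t\<^sup>2 \<noteq> 1"
proof -
  show eq: "s\<^sup>2 = - (t - 1 / t)\<^sup>2"
    using assms(1) by (simp add: assms(2) power2_sum power2_diff)
  show "s \<noteq> 0" using assms by auto
  then show "t\<^sup>2 \<noteq> 1" using eq by (auto simp: power2_eq_1_iff)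
qed

text \<open>Here \<open>x\<close> has order 2^(k+2), while \<open>b / a\<close> has order dividing
  2^l for equal signs and 2^(l+1) for opposite signs. The two bounds on \<open>l\<close> make
  \<open>b / a\<close> a power of \<open>x\<close>, and \<open>twist_mem\<close> applies.\<close>

lemma root_mem_rat_adjoin:
  fixes c q r s \<xi> :: complex
  assumes "s\<^sup>2 = 4 - c\<^sup>2" "c\<^sup>2 \<noteq> 4" "poly (cheb_C (2 ^ k)) \<xi> = 0"
    and "poly (cheb_C (2 ^ l)) q = c"
    and "poly (cheb_C (2 ^ l)) r = c \<and> l \<le> k + 2 \<or> poly (cheb_C (2 ^ l)) r = - c \<and> l \<le> k + 1"
  shows "r \<in> rat_adjoin {s, \<xi>, q}"
proof -
  interpret complex_subfield "rat_adjoin {s, \<xi>, q}" by (rule complex_subfield_rat_adjoin)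
  obtain t where t: "t \<noteq> 0" "c = t + 1 / t" by (rule obtain_plus_inverse)
  note s = sqrt_discriminant[OF t(1) assms(1,2)[unfolded t(2)]]
  obtain a where a: "a \<noteq> 0" "q = a + 1 / a" "a ^ 2 ^ l = t"
    using obtain_cheb_C_root assms(4) t by metis
  obtain x where x: "x \<noteq> 0" "\<xi> = x + 1 / x" "x ^ (2 * 2 ^ k) = -1"
    using obtain_cheb_C_zero assms(3) by metis
  obtain b where b: "b \<noteq> 0" "r = b + 1 / b"
    "b ^ 2 ^ l = t \<and> l \<le> k + 2 \<or> b ^ 2 ^ l = - t \<and> l \<le> k + 1"
  proof (cases "poly (cheb_C (2 ^ l)) r = c \<and> l \<le> k + 2")
    case True
    then show ?thesis using that obtain_cheb_C_root[of "2 ^ l" r t] t by metis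
  next
    case False
    then have "poly (cheb_C (2 ^ l)) r = - t + 1 / - t" "l \<le> k + 1"
      using assms(5) t by auto
    then show ?thesis using that obtain_cheb_C_root[of "2 ^ l" r "- t"] t by (metis neg_equal_0_iff_equal)
  qed
  have "\<exists>j. b / a = x ^ j"
    using b(3)
  proof
    assume "b ^ 2 ^ l = t \<and> l \<le> k + 2"
    then show ?thesis
      using root_of_unity_is_power[of x "Suc k" "b / a" l] a x t by (simp add: power_divide)
  next
    assume l: "b ^ 2 ^ l = - t \<and> l \<le> k + 1"
    then have "(b / a) ^ 2 ^ l = -1" using a t by (simp add: power_divide)
    then have "(b / a) ^ 2 ^ Suc l = 1" by (simp add: power_even_eq)
    then show ?thesis
      using root_of_unity_is_power[of x "Suc k" "b / a" "Suc l"] x l by simp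
  qed
  then obtain j where "b / a = x ^ j" by blast
  then have "b = x ^ j * a" using a(1) by (metis nonzero_divide_eq_eq)
  moreover have "x ^ j * a + 1 / (x ^ j * a) \<in> rat_adjoin {s, \<xi>, q}"
    by (rule twist_mem[where s = s and t = t])
      (use a x s in \<open>auto intro: rat_adjoin_mem simp flip: a(2) x(2)\<close>)
  ultimately show ?thesis using b by simp
qed

text \<open>The converse inclusion: \<open>z = b / a\<close> takes the place of \<open>x\<close>
  until \<open>z + 1 / z\<close> is known to lie in the field; \<open>s\<close> and then \<xi>
  follow from it.\<close>

lemma sqrt_and_xi_mem_rat_adjoin:
  fixes c q r s \<xi> :: complex
  assumes "s\<^sup>2 = 4 - c\<^sup>2" "c\<^sup>2 \<noteq> 4" "poly (cheb_C (2 ^ k)) \<xi> = 0"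
    and "poly (cheb_C (2 ^ Suc k)) q = c" "poly (cheb_C (2 ^ Suc k)) r = - c"
  shows "s \<in> rat_adjoin {q, r}" "\<xi> \<in> rat_adjoin {q, r}"
proof -
  interpret complex_subfield "rat_adjoin {q, r}" by (rule complex_subfield_rat_adjoin)
  obtain t where t: "t \<noteq> 0" "c = t + 1 / t" by (rule obtain_plus_inverse)
  note s = sqrt_discriminant[OF t(1) assms(1,2)[unfolded t(2)]]
  obtain a where a: "a \<noteq> 0" "q = a + 1 / a" "a ^ 2 ^ Suc k = t"
    using obtain_cheb_C_root assms(4) t by metis
  have "poly (cheb_C (2 ^ Suc k)) r = - t + 1 / - t" using assms(5) t by simp
  then obtain b where b: "b \<noteq> 0" "r = b + 1 / b" "b ^ 2 ^ Suc k = - t"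
    using obtain_cheb_C_root t by (metis neg_equal_0_iff_equal)
  obtain x where x: "x \<noteq> 0" "\<xi> = x + 1 / x" "x ^ (2 * 2 ^ k) = -1"
    using obtain_cheb_C_zero assms(3) by metis
  have qr: "a + 1 / a \<in> rat_adjoin {q, r}" "b + 1 / b \<in> rat_adjoin {q, r}"
    by (auto intro: rat_adjoin_mem simp flip: a(2) b(2))
  define z where "z = b / a"
  have z: "z \<noteq> 0" "b = z * a" "z ^ 2 ^ Suc k = -1"
    using a b t by (auto simp: z_def power_divide)
  define w where "w = z + 1 / z"
  \<comment> \<open>As \<open>z * a^2 = a * b\<close>, this is the conjugate of \<open>w\<close>
    under inversion of \<open>a\<close> with \<open>b\<close> fixed.\<close>
  define w' where "w' = z * a\<^sup>2 + 1 / (z * a\<^sup>2)"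
  have w: "w \<in> rat_adjoin {q, r}"
  proof (rule root_mem_if_conjugate_not_root[where w' = w' and k = "2 ^ k"])
    have "w + w' = (a + 1 / a) * (b + 1 / b)"
      using z(1) a(1) unfolding w_def w'_def z(2)
      by (simp add: algebra_simps add_divide_distrib power2_eq_square)
    then show "w + w' \<in> rat_adjoin {q, r}" using qr by (auto intro: mult_mem)
    have "w * w' = (a + 1 / a)\<^sup>2 + (b + 1 / b)\<^sup>2 - 4"
      using z(1) a(1) unfolding w_def w'_def z(2)
      by (simp add: algebra_simps add_divide_distrib power2_eq_square)
    then show "w * w' \<in> rat_adjoin {q, r}"
      by (simp only:) (intro qr field_mem)
    show "poly (cheb_C (2 ^ k)) w = 0"
      unfolding w_def poly_cheb_C_plus_inverse_eq_0_iff[OF z(1)] using z(3) by simp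
    have nz: "z * a\<^sup>2 \<noteq> 0" using z(1) a(1) by simp
    have "(z * a\<^sup>2) ^ 2 ^ Suc k = (z ^ 2 ^ Suc k) * (a ^ 2 ^ Suc k)\<^sup>2"
      by (simp add: power_mult_distrib mult.commute flip: power_mult)
    also have "\<dots> = - t\<^sup>2" using z a by simp
    finally have "(z * a\<^sup>2) ^ 2 ^ Suc k \<noteq> -1"
      using s(3) by simp
    then show "poly (cheb_C (2 ^ k)) w' \<noteq> 0"
      unfolding w'_def poly_cheb_C_plus_inverse_eq_0_iff[OF nz] by simp
  qed
  obtain u where u: "u \<in> rat_adjoin {q, r}" "s = u * ((z - 1 / z) * (a - 1 / a))"
    using sqrt_eq_multiple[OF qr(1) w[unfolded w_def] a(1) z(1) z(3)[unfolded power_Suc] a(3) s(1)]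
    by blast
  \<comment> \<open>The identity behind \<open>twist_mem\<close>, now solved for the
    product.\<close>
  have "(z - 1 / z) * (a - 1 / a) = 2 * (b + 1 / b) - w * (a + 1 / a)"
    using z(1) a(1) unfolding z(2) w_def
    by (simp add: algebra_simps add_divide_distrib diff_divide_distrib)
  then have "s = u * (2 * (b + 1 / b) - w * (a + 1 / a))" using u by simp
  also have "\<dots> \<in> rat_adjoin {q, r}" by (intro qr u w field_mem)
  finally show "s \<in> rat_adjoin {q, r}" .
  \<comment> \<open>The order of \<open>z\<close> is 2^(k+2), so \<open>x\<close> is a power of
    \<open>z\<close> and \<xi> is a Chebyshev value at \<open>w\<close>.\<close>
  have "x ^ 2 ^ Suc (Suc k) = (x ^ (2 * 2 ^ k))\<^sup>2"
    by (simp add: mult.commute flip: power_mult)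
  then have "x ^ 2 ^ Suc (Suc k) = 1"
    using x(3) by simp
  then obtain j where "x = z ^ j"
    using root_of_unity_is_power[OF z(3)] by blast
  then show "\<xi> \<in> rat_adjoin {q, r}"
    using power_plus_inverse_mem[OF w[unfolded w_def] z(1), of j] x(2) by simp
qed

text \<open>Keeping \<open>c\<close> general allows a second use with \<open>- c\<close> and the two
  roots exchanged, which gives the other description of L_n.\<close>

lemma rat_adjoin_root_pair:
  fixes c q r s \<xi> :: complex
  assumes "s\<^sup>2 = 4 - c\<^sup>2" "c\<^sup>2 \<noteq> 4" "poly (cheb_C (2 ^ k)) \<xi> = 0"
    and "poly (cheb_C (2 ^ Suc k)) q = c" "poly (cheb_C (2 ^ Suc k)) r = - c"
  shows "rat_adjoin {q, r} = rat_adjoin {s, \<xi>, q}"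
  using sqrt_and_xi_mem_rat_adjoin[OF assms] root_mem_rat_adjoin[OF assms(1-4), of r] assms(5)
  by (intro equalityI rat_adjoin_subsetI) (auto intro: rat_adjoin_mem)

text \<open>Reduction to \<open>rat_adjoin_root_pair\<close> for \<open>q^2 - 2\<close>, one level
  lower; adjoining \<open>q\<close> then only enlarges both sides.\<close>

lemma rat_adjoin_root_pair_Suc:
  fixes c q r s \<xi> :: complex
  assumes "s\<^sup>2 = 4 - c\<^sup>2" "c\<^sup>2 \<noteq> 4" "poly (cheb_C (2 ^ k)) \<xi> = 0"
    and "poly (cheb_C (2 ^ Suc (Suc k))) q = c" "poly (cheb_C (2 ^ Suc k)) r = - c"
  shows "rat_adjoin {q, r} = rat_adjoin {s, \<xi>, q}"
proof -
  have p: "poly (cheb_C (2 ^ Suc k)) (q\<^sup>2 - 2) = c"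
    using assms(4) poly_cheb_C_double[of "2 ^ Suc k" q] by simp
  have eq: "rat_adjoin {q\<^sup>2 - 2, r} = rat_adjoin {s, \<xi>, q\<^sup>2 - 2}"
    by (rule rat_adjoin_root_pair[OF assms(1-3) p assms(5)])
  have mem: "q\<^sup>2 - 2 \<in> rat_adjoin S" if "q \<in> S" for S
  proof -
    interpret complex_subfield "rat_adjoin S" by (rule complex_subfield_rat_adjoin)
    show ?thesis using that by (intro field_mem rat_adjoin_mem)
  qed
  have 1: "rat_adjoin {q\<^sup>2 - 2, r} \<subseteq> rat_adjoin {q, r}"
    using mem by (intro rat_adjoin_subsetI) (auto intro: rat_adjoin_mem)
  have 2: "rat_adjoin {s, \<xi>, q\<^sup>2 - 2} \<subseteq> rat_adjoin {s, \<xi>, q}"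
    using mem by (intro rat_adjoin_subsetI) (auto intro: rat_adjoin_mem)
  have "s \<in> rat_adjoin {q, r}" "\<xi> \<in> rat_adjoin {q, r}"
    using 1 unfolding eq by (auto intro: rat_adjoin_mem)
  moreover have "r \<in> rat_adjoin {s, \<xi>, q}"
    using 2 unfolding eq[symmetric] by (auto intro: rat_adjoin_mem)
  ultimately show ?thesis
    by (intro equalityI rat_adjoin_subsetI) (auto intro: rat_adjoin_mem)
qed

text \<open>Independence of the chosen root. For \<open>k = n - 1\<close> the bound on
  \<open>l\<close> includes level \<open>n + 1\<close>.\<close>

lemma rat_adjoin_root_cong:
  fixes c q r s \<xi> :: complex
  assumes "s\<^sup>2 = 4 - c\<^sup>2" "c\<^sup>2 \<noteq> 4" "poly (cheb_C (2 ^ k)) \<xi> = 0"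
    and "poly (cheb_C (2 ^ l)) q = c" "poly (cheb_C (2 ^ l)) r = c" "l \<le> k + 2"
  shows "rat_adjoin {s, \<xi>, q} = rat_adjoin {s, \<xi>, r}"
  using root_mem_rat_adjoin[OF assms(1-4), of r] root_mem_rat_adjoin[OF assms(1-3,5), of q] assms(4-6)
  by (intro equalityI rat_adjoin_subsetI) (auto intro: rat_adjoin_mem)

theorem theorem18:
  fixes q0 \<delta> :: rat and n :: nat
    and qn qn1 qhn qhn1 \<xi> s :: complex
  assumes "q0 \<noteq> 2" and "q0 \<noteq> -2"
    and "\<delta> = q0\<^sup>2 - 4"
    and "n \<ge> 1"
    and "poly (cheb_C (2 ^ n) - [:of_rat q0:]) qn = 0"
    and "poly (cheb_C (2 ^ (n + 1)) - [:of_rat q0:]) qn1 = 0"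
    and "poly (cheb_C (2 ^ n) + [:of_rat q0:]) qhn = 0"
    and "poly (cheb_C (2 ^ (n + 1)) + [:of_rat q0:]) qhn1 = 0"
    and "poly (cheb_C (2 ^ (n - 1))) \<xi> = 0"
    and "s\<^sup>2 = - of_rat \<delta>"
  shows "rat_adjoin {qn, qhn} = rat_adjoin {s, \<xi>, qn} \<and>
         rat_adjoin {qn, qhn} = rat_adjoin {s, \<xi>, qhn} \<and>
         rat_adjoin {qn1, qhn} = rat_adjoin {s, \<xi>, qn1} \<and>
         rat_adjoin {qn, qhn1} = rat_adjoin {s, \<xi>, qhn1} \<and>
         (\<forall>rn rn1 rhn rhn1.
            poly (cheb_C (2 ^ n) - [:of_rat q0:]) rn = 0 \<longrightarrow>
            poly (cheb_C (2 ^ (n + 1)) - [:of_rat q0:]) rn1 = 0 \<longrightarrow>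
            poly (cheb_C (2 ^ n) + [:of_rat q0:]) rhn = 0 \<longrightarrow>
            poly (cheb_C (2 ^ (n + 1)) + [:of_rat q0:]) rhn1 = 0 \<longrightarrow>
            rat_adjoin {rn, rhn} = rat_adjoin {qn, qhn} \<and>
            rat_adjoin {rn1, rhn} = rat_adjoin {qn1, qhn} \<and>
            rat_adjoin {rn, rhn1} = rat_adjoin {qn, qhn1})"
proof -
  define c where "c = (of_rat q0 :: complex)"
  obtain k where n: "n = Suc k" using assms(4) by (cases n) auto
  have s: "s\<^sup>2 = 4 - c\<^sup>2"
    using assms(3,10) by (simp add: c_def of_rat_diff of_rat_power)
  have "q0\<^sup>2 \<noteq> 2\<^sup>2" using assms(1,2) by (simp only: power2_eq_iff) simp
  then have "c\<^sup>2 \<noteq> of_rat 4"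
    unfolding c_def of_rat_power[symmetric] of_rat_eq_iff by simp
  then have c: "c\<^sup>2 \<noteq> 4" by simp
  \<comment> \<open>The hatted roots belong to \<open>- c\<close> with the same \<open>s\<close>, so
    every lemma above is available for both signs.\<close>
  have s': "s\<^sup>2 = 4 - (- c)\<^sup>2" and c': "(- c)\<^sup>2 \<noteq> 4" using s c by auto
  have \<xi>: "poly (cheb_C (2 ^ k)) \<xi> = 0" using assms(9) n by simp
  have minus_iff: "poly (p - [:of_rat q0:]) z = 0 \<longleftrightarrow> poly p z = c"
    and plus_iff: "poly (p + [:of_rat q0:]) z = 0 \<longleftrightarrow> poly p z = - c" for p and z :: complex
    by (auto simp: c_def eq_neg_iff_add_eq_0)
  have L: "rat_adjoin {r, rh} = rat_adjoin {s, \<xi>, r}" "rat_adjoin {r, rh} = rat_adjoin {s, \<xi>, rh}"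
    if "poly (cheb_C (2 ^ n)) r = c" "poly (cheb_C (2 ^ n)) rh = - c" for r rh
    using rat_adjoin_root_pair[OF s c \<xi>, of r rh] rat_adjoin_root_pair[OF s' c' \<xi>, of rh r] that
    by (auto simp: n insert_commute)
  have Mp: "rat_adjoin {r, rh} = rat_adjoin {s, \<xi>, r}"
    if "poly (cheb_C (2 ^ (n + 1))) r = c" "poly (cheb_C (2 ^ n)) rh = - c" for r rh
    using rat_adjoin_root_pair_Suc[OF s c \<xi>, of r rh] that by (simp add: n)
  have Mm: "rat_adjoin {r, rh} = rat_adjoin {s, \<xi>, rh}"
    if "poly (cheb_C (2 ^ n)) r = c" "poly (cheb_C (2 ^ (n + 1))) rh = - c" for r rh
    using rat_adjoin_root_pair_Suc[OF s' c' \<xi>, of rh r] that by (simp add: n insert_commute)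
  have cong: "rat_adjoin {s, \<xi>, q} = rat_adjoin {s, \<xi>, r}"
    if "poly (cheb_C (2 ^ l)) q = c \<and> poly (cheb_C (2 ^ l)) r = c \<or>
        poly (cheb_C (2 ^ l)) q = - c \<and> poly (cheb_C (2 ^ l)) r = - c" "l \<le> n + 1" for l q r
    using that rat_adjoin_root_cong[OF s c \<xi>, of l q r] rat_adjoin_root_cong[OF s' c' \<xi>, of l q r]
    by (auto simp: n)
  note roots = assms(5-8)[unfolded minus_iff plus_iff]
  show ?thesis
    unfolding minus_iff plus_iff
  proof (intro conjI allI impI)
    show "rat_adjoin {qn, qhn} = rat_adjoin {s, \<xi>, qn}"
      "rat_adjoin {qn, qhn} = rat_adjoin {s, \<xi>, qhn}"
      using L roots by blast+
    show "rat_adjoin {qn1, qhn} = rat_adjoin {s, \<xi>, qn1}" using Mp roots by blast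
    show "rat_adjoin {qn, qhn1} = rat_adjoin {s, \<xi>, qhn1}" using Mm roots by blast
  next
    fix rn rn1 rhn rhn1
    assume r: "poly (cheb_C (2 ^ n)) rn = c" "poly (cheb_C (2 ^ (n + 1))) rn1 = c"
      "poly (cheb_C (2 ^ n)) rhn = - c" "poly (cheb_C (2 ^ (n + 1))) rhn1 = - c"
    \<comment> \<open>Both sides are rewritten with the same \<open>s\<close> and \<xi> and one
      remaining root, which \<open>cong\<close> then exchanges.\<close>
    show "rat_adjoin {rn, rhn} = rat_adjoin {qn, qhn}"
      using L(1)[OF r(1,3)] L(1)[OF roots(1,3)] cong[of n rn qn] r roots by simp
    show "rat_adjoin {rn1, rhn} = rat_adjoin {qn1, qhn}"
      using Mp[OF r(2,3)] Mp[OF roots(2,3)] cong[of "n + 1" rn1 qn1] r roots by simp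
    show "rat_adjoin {rn, rhn1} = rat_adjoin {qn, qhn1}"
      using Mm[OF r(1,4)] Mm[OF roots(1,4)] cong[of "n + 1" rhn1 qhn1] r roots by simp
  qed
qed

end
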